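(* Let $0<q<1$ and let $l,\lambda\in\mathbb{R}$ with $l\neq0$. The Fubini-Study metric $$d\sigma^2=\big\|d|z\rangle_{l,\lambda}\big\|^2-\big|{}_{l,\lambda}\langle z|\,d|z\rangle_{l,\lambda}\big|^2$$ induced by the map $z\mapsto|z\rangle_{l,\lambda}$ from $\mathbb{C}$ to the unit vectors of the Hilbert space reduces to $$d\sigma^2=W_{l,\lambda}(x)\,d\bar z\,dz,\qquad x=|z|^2,\qquad W_{l,\lambda}(x)=\left(x\frac{\mathcal N_{l,\lambda}'(x)}{\mathcal N_{l,\lambda}(x)}\right)'=\frac{d}{dx}\langle N\rangle.$$ In polar coordinates $z=re^{i\theta}$, $d\sigma^2=W_{l,\lambda}(r^2)\,(dr^2+r^2d\theta^2)$.
   Context: $\mathcal{F}$ is a Hilbert space with orthonormal basis $\{|n\rangle:n=0,1,2,\dots\}$, and $N|n\rangle=n|n\rangle$. $[n]_q=\frac{1-q^n}{1-q}$, $[0]_q!=1$, $[n]_q!=[n]_q\cdots[1]_q$. For $0<q<1$ and $z\in\mathbb{C}$ the coherent states are $$|z\rangle_{l,\lambda}=\mathcal N_{l,\lambda}(|z|^2)^{-1/2}\sum_{n=0}^\infty\frac{q^{n(n+1)/4}z^n}{\sqrt{(l^2q^\lambda)^n[n]_q!}}\,|n\rangle,\qquad \mathcal N_{l,\lambda}(x)=\sum_{n=0}^\infty\frac{q^{n(n+1)/2}x^n}{(l^2q^\lambda)^n[n]_q!}.$$ $\langle N\rangle={}_{l,\lambda}\langle z|N|z\rangle_{l,\lambda}$,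 regarded as a function of $x=|z|^2$; a prime denotes $d/dx$. Here $d|z\rangle_{l,\lambda}$ is the (real) differential of the map $z\mapsto|z\rangle_{l,\lambda}$: evaluated on a tangent vector $w\in\mathbb{C}\cong T_z\mathbb{C}$, $d|z\rangle_{l,\lambda}(w)=\frac{d}{dt}\big|_{t=0}|z+tw\rangle_{l,\lambda}$ ($t$ real), and $d\bar z\,dz$ evaluated on $w$ is $|w|^2$. *)

theory Defs
  imports "HOL-Analysis.Analysis"
begin

text \<open>
  Complex Hilbert spaces: complete complex inner product spaces.  The sesquilinear form is
  antilinear in its first argument (bra-ket convention), and the norm, topology and real
  scalar multiplication of the underlying Banach space are the ones induced by the complex
  structure.
\<close>

class complex_hilbert = banach +
  fixes scaleC :: "complex \<Rightarrow> 'a \<Rightarrow> 'a" (infixr "*\<^sub>C" 75)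
    and cinner :: "'a \<Rightarrow> 'a \<Rightarrow> complex"
  assumes scaleC_add_right: "c *\<^sub>C (x + y) = c *\<^sub>C x + c *\<^sub>C y"
    and scaleC_add_left: "(c + d) *\<^sub>C x = c *\<^sub>C x + d *\<^sub>C x"
    and scaleC_scaleC: "c *\<^sub>C (d *\<^sub>C x) = (c * d) *\<^sub>C x"
    and scaleC_of_real: "complex_of_real r *\<^sub>C x = r *\<^sub>R x"
    and cinner_commute: "cinner x y = cnj (cinner y x)"
    and cinner_add_right: "cinner x (y + z) = cinner x y + cinner x z"
    and cinner_scaleC_right: "cinner x (c *\<^sub>C y) = c * cinner x y"
    and cinner_self: "cinner x x = complex_of_real ((norm x)\<^sup>2)"

definition orthonormal_basis :: "(nat \<Rightarrow> 'a::complex_hilbert) \<Rightarrow> bool" where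
  "orthonormal_basis e \<longleftrightarrow>
     (\<forall>m n. cinner (e m) (e n) = (if m = n then 1 else 0)) \<and>
     closure {\<Sum>n<k. c n *\<^sub>C e n | k c. True} = UNIV"

text \<open>
  The unbounded operator with \<open>N (e n) = n \<cdot> e n\<close> on its maximal (self-adjoint) domain;
  \<open>number_op\<close> is meaningful on \<open>number_domain\<close> only.
\<close>

definition number_domain :: "(nat \<Rightarrow> 'a::complex_hilbert) \<Rightarrow> 'a set" where
  "number_domain e = {v. summable (\<lambda>n. (real n * cmod (cinner (e n) v))\<^sup>2)}"

definition number_op :: "(nat \<Rightarrow> 'a::complex_hilbert) \<Rightarrow> 'a \<Rightarrow> 'a" where
  "number_op e v = (\<Sum>n. (of_nat n * cinner (e n) v) *\<^sub>C e n)"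

definition q_number :: "real \<Rightarrow> nat \<Rightarrow> real" where
  "q_number q n = (1 - q ^ n) / (1 - q)"

definition q_fact :: "real \<Rightarrow> nat \<Rightarrow> real" where
  "q_fact q n = (\<Prod>k=1..n. q_number q k)"

definition normalization :: "real \<Rightarrow> real \<Rightarrow> real \<Rightarrow> real \<Rightarrow> real" where
  "normalization q l lam x =
     (\<Sum>n. q powr (real n * (real n + 1) / 2) * x ^ n / ((l\<^sup>2 * q powr lam) ^ n * q_fact q n))"

definition coherent_state ::
  "(nat \<Rightarrow> 'a::complex_hilbert) \<Rightarrow> real \<Rightarrow> real \<Rightarrow> real \<Rightarrow> complex \<Rightarrow> 'a" where
  "coherent_state e q l lam z =
     (normalization q l lam ((cmod z)\<^sup>2) powr (- 1 / 2)) *\<^sub>R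
     (\<Sum>n. (complex_of_real (q powr (real n * (real n + 1) / 4)) * z ^ n /
             complex_of_real (sqrt ((l\<^sup>2 * q powr lam) ^ n * q_fact q n))) *\<^sub>C e n)"

definition mean_number ::
  "(nat \<Rightarrow> 'a::complex_hilbert) \<Rightarrow> real \<Rightarrow> real \<Rightarrow> real \<Rightarrow> complex \<Rightarrow> complex" where
  "mean_number e q l lam z =
     cinner (coherent_state e q l lam z) (number_op e (coherent_state e q l lam z))"

definition differential ::
  "('b::real_normed_vector \<Rightarrow> 'c::real_normed_vector) \<Rightarrow> 'b \<Rightarrow> 'b \<Rightarrow> 'c" where
  "differential f p v = vector_derivative (\<lambda>t. f (p + t *\<^sub>R v)) (at 0)"

text \<open>
  The quadratic form at the point \<open>p\<close>, evaluated on the tangent vector \<open>v\<close>.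
\<close>

definition fubini_study ::
  "('b::real_normed_vector \<Rightarrow> 'a::complex_hilbert) \<Rightarrow> 'b \<Rightarrow> 'b \<Rightarrow> real" where
  "fubini_study f p v =
     (norm (differential f p v))\<^sup>2 - (cmod (cinner (f p) (differential f p v)))\<^sup>2"

definition log_deriv_term :: "real \<Rightarrow> real \<Rightarrow> real \<Rightarrow> real \<Rightarrow> real" where
  "log_deriv_term q l lam x =
     x * (deriv (normalization q l lam) x / normalization q l lam x)"

definition metric_factor :: "real \<Rightarrow> real \<Rightarrow> real \<Rightarrow> real \<Rightarrow> real" where
  "metric_factor q l lam x = deriv (log_deriv_term q l lam) x"

end

theory Submission
  imports Defs
begin

text \<open>
  With \<open>a n\<close> the coefficients of the normalization \<open>\<N>\<close>, the state is \<open>\<psi> = V(z) / \<surd>\<N>(x)\<close> for the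
  Hilbert-space valued power series \<open>V(z) = \<Sum> \<surd>(a n) z\<^sup>n e\<^sub>n\<close>, which is entire with complex derivative
  \<open>V'\<close>.  Orthonormality gives \<open>\<langle>V,V\<rangle> = \<N>\<close>, \<open>\<langle>V,V'\<rangle> = cnj z \<N>'\<close> and \<open>\<langle>V',V'\<rangle> = (x \<N>')'\<close>, all at
  \<open>x = |z|\<^sup>2\<close>.  The differential of the real factor \<open>1/\<surd>\<N>\<close> points along \<open>V\<close>, so the metric only sees the
  component of \<open>V'\<close> orthogonal to \<open>V\<close>: its factor is \<open>\<langle>V',V'\<rangle>/\<N> - |\<langle>V,V'\<rangle>|\<^sup>2/\<N>\<^sup>2 = (x \<N>'/\<N>)'\<close>.
\<close>

subsection \<open>Complex Hilbert spaces\<close>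

lemma cinner_add_left: "cinner (x + y) (z::'a::complex_hilbert) = cinner x z + cinner y z"
  by (metis cinner_commute cinner_add_right complex_cnj_add)

lemma cinner_scaleC_left: "cinner (c *\<^sub>C x) (y::'a::complex_hilbert) = cnj c * cinner x y"
  by (metis cinner_commute cinner_scaleC_right complex_cnj_mult)

lemma cinner_scaleR_right: "cinner x (r *\<^sub>R (y::'a::complex_hilbert)) = of_real r * cinner x y"
  by (metis cinner_scaleC_right scaleC_of_real)

lemma cinner_scaleR_left: "cinner (r *\<^sub>R x) (y::'a::complex_hilbert) = of_real r * cinner x y"
  by (metis cinner_scaleC_left scaleC_of_real complex_cnj_complex_of_real)

lemma cinner_zero_right [simp]: "cinner x (0::'a::complex_hilbert) = 0"
  using cinner_scaleR_right[of x 0 0] by simp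

lemma cinner_zero_left [simp]: "cinner (0::'a::complex_hilbert) x = 0"
  using cinner_scaleR_left[of 0 0 x] by simp

lemma cinner_minus_right: "cinner x (- y::'a::complex_hilbert) = - cinner x y"
  using cinner_scaleR_right[of x "-1" y] by simp

lemma cinner_minus_left: "cinner (- x) (y::'a::complex_hilbert) = - cinner x y"
  using cinner_scaleR_left[of "-1" x y] by simp

lemma cinner_sum_right: "cinner x (\<Sum>i\<in>A. f i :: 'a::complex_hilbert) = (\<Sum>i\<in>A. cinner x (f i))"
  by (induction A rule: infinite_finite_induct) (auto simp: cinner_add_right)

lemma cinner_sum_left: "cinner (\<Sum>i\<in>A. f i :: 'a::complex_hilbert) x = (\<Sum>i\<in>A. cinner (f i) x)"
  by (induction A rule: infinite_finite_induct) (auto simp: cinner_add_left)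

lemma norm_square_cinner: "(norm (x::'a::complex_hilbert))\<^sup>2 = Re (cinner x x)"
  by (simp add: cinner_self)

lemma norm_add_square:
  "(norm (x + y :: 'a::complex_hilbert))\<^sup>2 = (norm x)\<^sup>2 + 2 * Re (cinner x y) + (norm y)\<^sup>2"
proof -
  have "Re (cinner y x) = Re (cinner x y)"
    by (subst cinner_commute) simp
  then show ?thesis
    by (simp add: norm_square_cinner cinner_add_left cinner_add_right)
qed

text \<open>The Banach structure gives homogeneity for real scalars only; for complex
  \<open>c\<close> it comes from pulling \<open>cnj c * c = |c|^2\<close> out of the inner
  product.\<close>

lemma norm_scaleC: "norm (c *\<^sub>C (x::'a::complex_hilbert)) = cmod c * norm x"
proof -
  have "cnj c * c = of_real ((cmod c)\<^sup>2)"
    by (metis complex_norm_square mult.commute)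
  then have "complex_of_real ((norm (c *\<^sub>C x))\<^sup>2) = of_real ((cmod c)\<^sup>2 * (norm x)\<^sup>2)"
    unfolding cinner_self[symmetric] cinner_scaleC_left cinner_scaleC_right
    by (simp add: cinner_self mult.assoc[symmetric] mult.commute)
  then have "(norm (c *\<^sub>C x))\<^sup>2 = (cmod c * norm x)\<^sup>2"
    by (simp only: of_real_eq_iff power_mult_distrib)
  then show ?thesis
    by (simp add: power2_eq_iff_nonneg)
qed

lemma scaleR_scaleC: "r *\<^sub>R (c *\<^sub>C (x::'a::complex_hilbert)) = (of_real r * c) *\<^sub>C x"
  by (simp add: scaleC_of_real[symmetric] scaleC_scaleC)

lemma bounded_bilinear_scaleC:
  "bounded_bilinear (\<lambda>c (x::'a::complex_hilbert). c *\<^sub>C x)"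
proof
  show "\<exists>K. \<forall>c (x::'a). norm (c *\<^sub>C x) \<le> norm c * norm x * K"
    by (rule exI[of _ 1]) (simp add: norm_scaleC)
qed (auto simp: scaleC_add_left scaleC_add_right scaleR_scaleC scaleC_scaleC scaleR_conv_of_real
       scaleC_of_real[symmetric] mult.commute)

lemmas bounded_linear_scaleC_left = bounded_bilinear.bounded_linear_left[OF bounded_bilinear_scaleC]
lemmas bounded_linear_scaleC_right = bounded_bilinear.bounded_linear_right[OF bounded_bilinear_scaleC]

text \<open>By polarization, continuity of the inner product reduces to continuity of the norm.\<close>

lemma Re_cinner_polarization:
  "Re (cinner x (y::'a::complex_hilbert)) = ((norm (x + y))\<^sup>2 - (norm (x - y))\<^sup>2) / 4"
  using norm_add_square[of x y] norm_add_square[of x "- y"] by (simp add: cinner_minus_right)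

lemma tendsto_cinner:
  fixes f g :: "'b \<Rightarrow> 'a::complex_hilbert"
  assumes "(f \<longlongrightarrow> x) F" and "(g \<longlongrightarrow> y) F"
  shows "((\<lambda>t. cinner (f t) (g t)) \<longlongrightarrow> cinner x y) F"
proof -
  have re: "((\<lambda>t. Re (cinner (f t) (h t))) \<longlongrightarrow> Re (cinner x v)) F" if "(h \<longlongrightarrow> v) F" for h v
    unfolding Re_cinner_polarization using that assms by (intro tendsto_intros) auto
  \<comment> \<open>Linearity in the second argument turns the imaginary part into a real part, so
    polarization covers both.\<close>
  have im: "Im (cinner u v) = Re (cinner u ((- \<i>) *\<^sub>C v))" for u v :: 'a
    by (simp add: cinner_scaleC_right)
  have "((\<lambda>t. (- \<i>) *\<^sub>C g t) \<longlongrightarrow> (- \<i>) *\<^sub>C y) F"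
    by (rule bounded_linear.tendsto[OF bounded_linear_scaleC_right assms(2)])
  then show ?thesis
    unfolding tendsto_complex_iff im by (intro conjI re assms)
qed

text \<open>Orthonormality collapses the double sum over two partial sums of equal length to a
  single sum, and continuity of the inner product passes to the limit. Convergence of the scalar
  series is thus part of the conclusion.\<close>

lemma cinner_orthonormal_sums:
  fixes e :: "nat \<Rightarrow> 'a::complex_hilbert"
  assumes on: "\<And>m n. cinner (e m) (e n) = (if m = n then 1 else 0)"
    and "(\<lambda>n. c n *\<^sub>C e n) sums x" and "(\<lambda>n. d n *\<^sub>C e n) sums y"
  shows "(\<lambda>n. cnj (c n) * d n) sums cinner x y"
proof -
  have "cinner (\<Sum>i<n. c i *\<^sub>C e i) (\<Sum>i<n. d i *\<^sub>C e i) = (\<Sum>i<n. cnj (c i) * d i)" for n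
    by (simp add: cinner_sum_left cinner_sum_right cinner_scaleC_left cinner_scaleC_right on
        if_distrib[where f = "\<lambda>t. _ * t"] sum.delta mult.commute cong: if_cong)
  moreover have "(\<lambda>n. cinner (\<Sum>i<n. c i *\<^sub>C e i) (\<Sum>i<n. d i *\<^sub>C e i)) \<longlonglongrightarrow> cinner x y"
    using assms(2,3) unfolding sums_def by (rule tendsto_cinner)
  ultimately show ?thesis
    by (simp add: sums_def)
qed

lemma cinner_orthonormal_coefficient:
  fixes e :: "nat \<Rightarrow> 'a::complex_hilbert"
  assumes on: "\<And>m n. cinner (e m) (e n) = (if m = n then 1 else 0)"
    and "(\<lambda>n. d n *\<^sub>C e n) sums y"
  shows "cinner (e m) y = d m"
proof -
  have "(\<lambda>n. (if n = m then d n else 0)) sums d m"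
    by (rule sums_single)
  moreover have "(\<lambda>n. cinner (e m) (d n *\<^sub>C e n)) sums cinner (e m) y"
    using tendsto_cinner[OF tendsto_const assms(2)[unfolded sums_def], of "e m"]
    by (simp add: sums_def cinner_sum_right)
  moreover have "(\<lambda>n. cinner (e m) (d n *\<^sub>C e n)) = (\<lambda>n. (if n = m then d n else 0))"
    by (auto simp: cinner_scaleC_right on)
  ultimately show ?thesis
    by (metis sums_unique2)
qed

subsection \<open>Everywhere convergent power series\<close>

text \<open>Termwise differentiation, with the shifted coefficients \<open>diffs c\<close>
  reindexed. The truncated \<open>n - 1\<close> is harmless: the factor \<open>n\<close> kills the
  term at 0.\<close>

lemma entire_series_derivative:
  fixes c :: "nat \<Rightarrow> real"
  assumes "\<And>x. summable (\<lambda>n. c n * x ^ n)"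
  shows "summable (\<lambda>n. of_nat n * c n * x ^ (n - 1))"
    and "((\<lambda>x. \<Sum>n. c n * x ^ n) has_real_derivative (\<Sum>n. of_nat n * c n * x ^ (n - 1))) (at x)"
proof -
  have "summable (\<lambda>n. diffs c n * x ^ n)"
    by (rule termdiff_converges_all) (rule assms)
  then have sums: "(\<lambda>n. of_nat n * c n * x ^ (n - 1)) sums (\<Sum>n. diffs c n * x ^ n)"
    using diffs_equiv by simp
  then show "summable (\<lambda>n. of_nat n * c n * x ^ (n - 1))"
    by (rule sums_summable)
  show "((\<lambda>x. \<Sum>n. c n * x ^ n) has_real_derivative (\<Sum>n. of_nat n * c n * x ^ (n - 1))) (at x)"
    using termdiffs_strong_converges_everywhere[of c x] assms sums_unique[OF sums] by simp
qed

lemma mult_power_pred: "of_nat n * c * x ^ (n - 1) * x = of_nat n * (c::'b::comm_semiring_1) * x ^ n"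
  by (cases n) (auto simp: ac_simps)

text \<open>The operator x d/dx multiplies the n-th coefficient by \<open>n\<close>. The weighted
  coefficients again define an entire series, so differentiation can be iterated.\<close>

lemma entire_series_Euler:
  fixes c :: "nat \<Rightarrow> real"
  assumes "\<And>x. summable (\<lambda>n. c n * x ^ n)"
  shows "(\<lambda>n. of_nat n * c n * x ^ n) sums (x * (\<Sum>n. of_nat n * c n * x ^ (n - 1)))"
  using sums_mult2[OF summable_sums[OF entire_series_derivative(1)[OF assms, of x]], of x]
  by (simp only: mult_power_pred mult.commute[of x])

text \<open>In absolute value each term is at most \<open>r n * \<bar>x\<bar>\<close> times its
  predecessor, and this factor tends to 0 for every \<open>x\<close>.\<close>

lemma summable_power_series_ratio:
  fixes c r :: "nat \<Rightarrow> real"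
  assumes "\<And>n. c n \<ge> 0" and "\<And>n. c (Suc n) \<le> r n * c n" and "r \<longlonglongrightarrow> 0"
  shows "summable (\<lambda>n. c n * x ^ n)"
proof -
  have "(\<lambda>n. r n * \<bar>x\<bar>) \<longlonglongrightarrow> 0"
    using tendsto_mult_left_zero[OF assms(3)] .
  then have "\<forall>\<^sub>F n in sequentially. r n * \<bar>x\<bar> < 1 / 2"
    by (rule order_tendstoD) simp
  then obtain K where K: "\<And>n. n \<ge> K \<Longrightarrow> r n * \<bar>x\<bar> < 1 / 2"
    by (auto simp: eventually_sequentially)
  show ?thesis
  proof (rule summable_ratio_test[of "1/2" K])
    fix n assume "n \<ge> K"
    have "norm (c (Suc n) * x ^ Suc n) \<le> r n * c n * (\<bar>x\<bar> * \<bar>x\<bar> ^ n)"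
      using assms(1,2) by (auto simp: abs_mult power_abs intro!: mult_right_mono)
    also have "\<dots> = (r n * \<bar>x\<bar>) * (c n * \<bar>x\<bar> ^ n)"
      by simp
    also have "\<dots> \<le> 1 / 2 * (c n * \<bar>x\<bar> ^ n)"
      using K[OF \<open>n \<ge> K\<close>] assms(1) by (intro mult_right_mono) auto
    finally show "norm (c (Suc n) * x ^ Suc n) \<le> 1 / 2 * norm (c n * x ^ n)"
      using assms(1) by (simp add: abs_mult power_abs)
  qed simp
qed

text \<open>Termwise differentiation on a ball around 0, justified by the Weierstrass M-test for the
  differentiated series. That \<open>h\<close> acts by complex multiplication on a fixed vector
  expresses complex differentiability.\<close>

lemma has_derivative_vector_power_series:
  fixes u :: "nat \<Rightarrow> 'a::complex_hilbert"
  assumes "\<And>R::real. summable (\<lambda>n. norm (u n) * R ^ n)"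
  shows "(\<lambda>n. z ^ n *\<^sub>C u n) sums (\<Sum>n. z ^ n *\<^sub>C u n)" (is ?A)
    and "(\<lambda>n. (of_nat n * z ^ (n - 1)) *\<^sub>C u n) sums (\<Sum>n. (of_nat n * z ^ (n - 1)) *\<^sub>C u n)" (is ?B)
    and "((\<lambda>z. \<Sum>n. z ^ n *\<^sub>C u n) has_derivative
            (\<lambda>h. h *\<^sub>C (\<Sum>n. (of_nat n * z ^ (n - 1)) *\<^sub>C u n))) (at z)" (is ?C)
proof -
  define D where "D x = (\<Sum>n. (of_nat n * x ^ (n - 1)) *\<^sub>C u n)" for x
  \<comment> \<open>Any radius beyond |z| would do: \<open>z\<close> becomes an interior point of
    the ball on which \<open>M\<close> majorizes the differentiated terms.\<close>
  define R where "R = cmod z + 1"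
  define M where "M n = of_nat n * norm (u n) * R ^ (n - 1)" for n
  have sA: "summable (\<lambda>n. z ^ n *\<^sub>C u n)" for z
    by (rule summable_norm_cancel)
       (use assms[of "cmod z"] in \<open>simp add: norm_scaleC norm_power mult.commute\<close>)
  then show ?A by (rule summable_sums)
  have sM: "summable M"
    unfolding M_def by (rule entire_series_derivative(1)[OF assms])
  have bound: "norm ((of_nat n * x ^ (n - 1)) *\<^sub>C u n) \<le> M n" if "x \<in> ball 0 R" for x n
  proof -
    have "cmod x ^ (n - 1) \<le> R ^ (n - 1)"
      using that by (intro power_mono) auto
    then have "of_nat n * norm (u n) * cmod x ^ (n - 1) \<le> M n"
      unfolding M_def by (intro mult_left_mono) auto
    then show ?thesis
      by (simp add: norm_scaleC norm_mult norm_power ac_simps)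
  qed
  have zR: "z \<in> ball 0 R" by (simp add: R_def)
  have "summable (\<lambda>n. (of_nat n * z ^ (n - 1)) *\<^sub>C u n)"
    using bound[OF zR] by (intro summable_comparison_test'[OF sM]) auto
  then show ?B by (rule summable_sums)
  have unif: "uniform_limit (ball 0 R) (\<lambda>n x. \<Sum>i<n. (of_nat i * x ^ (i - 1)) *\<^sub>C u i) D sequentially"
    unfolding D_def using bound sM by (rule Weierstrass_m_test)
  have "\<exists>g. \<forall>x\<in>ball 0 R. (\<lambda>n. x ^ n *\<^sub>C u n) sums g x \<and>
          (g has_derivative (\<lambda>h. h *\<^sub>C D x)) (at x within ball 0 R)"
  proof (rule has_derivative_series[where f' = "\<lambda>n x h. (of_nat n * x ^ (n - 1) * h) *\<^sub>C u n"])
    show "convex (ball (0::complex) R)" by simp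
    show "((\<lambda>x. x ^ n *\<^sub>C u n) has_derivative (\<lambda>h. (of_nat n * x ^ (n - 1) * h) *\<^sub>C u n))
            (at x within ball 0 R)" for n x
      by (rule bounded_linear.has_derivative[OF bounded_linear_scaleC_left])
         (auto intro!: derivative_eq_intros)
    show "z \<in> ball 0 R" by (rule zR)
    show "(\<lambda>n. z ^ n *\<^sub>C u n) sums (\<Sum>n. z ^ n *\<^sub>C u n)"
      by (rule summable_sums[OF sA])
    fix \<epsilon> :: real assume "\<epsilon> > 0"
    with unif have "\<forall>\<^sub>F n in sequentially. \<forall>x\<in>ball 0 R.
        dist (\<Sum>i<n. (of_nat i * x ^ (i - 1)) *\<^sub>C u i) (D x) < \<epsilon>"
      by (rule uniform_limitD)
    then show "\<forall>\<^sub>F n in sequentially. \<forall>x\<in>ball 0 R. \<forall>h.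
        norm ((\<Sum>i<n. (of_nat i * x ^ (i - 1) * h) *\<^sub>C u i) - h *\<^sub>C D x) \<le> \<epsilon> * norm h"
    proof (eventually_elim, intro ballI allI)
      fix n and x h :: complex
      assume *: "\<forall>x\<in>ball 0 R. dist (\<Sum>i<n. (of_nat i * x ^ (i - 1)) *\<^sub>C u i) (D x) < \<epsilon>"
        and x: "x \<in> ball 0 R"
      \<comment> \<open>The increment \<open>h\<close> factors out of the remainder, so uniform
        convergence of the differentiated series yields the required bound.\<close>
      have "(\<Sum>i<n. (of_nat i * x ^ (i - 1) * h) *\<^sub>C u i) - h *\<^sub>C D x =
            h *\<^sub>C ((\<Sum>i<n. (of_nat i * x ^ (i - 1)) *\<^sub>C u i) - D x)"
        by (simp add: bounded_bilinear.diff_right[OF bounded_bilinear_scaleC]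
            bounded_bilinear.sum_right[OF bounded_bilinear_scaleC] scaleC_scaleC mult.commute)
      then show "norm ((\<Sum>i<n. (of_nat i * x ^ (i - 1) * h) *\<^sub>C u i) - h *\<^sub>C D x) \<le> \<epsilon> * norm h"
        using *[rule_format, OF x]
        by (simp add: norm_scaleC dist_norm mult.commute[of \<epsilon>] mult_left_mono)
    qed
  qed
  then obtain g where g: "\<And>x. x \<in> ball 0 R \<Longrightarrow> (\<lambda>n. x ^ n *\<^sub>C u n) sums g x"
      "\<And>x. x \<in> ball 0 R \<Longrightarrow> (g has_derivative (\<lambda>h. h *\<^sub>C D x)) (at x within ball 0 R)"
    by blast
  have "(g has_derivative (\<lambda>h. h *\<^sub>C D z)) (at z)"
    using g(2)[OF zR] at_within_open[OF zR] by simp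
  \<comment> \<open>The function \<open>g\<close> is only known to exist; uniqueness of limits
    identifies it with the series on the ball.\<close>
  then show ?C
    unfolding D_def[symmetric]
    by (rule has_derivative_transform_within_open[OF _ open_ball zR]) (metis g(1) sums_unique)
qed

subsection \<open>States with power series coefficients\<close>

text \<open>Chain rule along the line through \<open>p\<close> in direction
  \<open>v\<close>.\<close>

lemma differential_eq:
  assumes "(f has_derivative f') (at p)"
  shows "differential f p v = f' v"
proof -
  have "((\<lambda>t. p + t *\<^sub>R v) has_derivative (\<lambda>t. t *\<^sub>R v)) (at 0)"
    by (auto intro!: derivative_eq_intros)
  moreover have "(f has_derivative f') (at (p + 0 *\<^sub>R v))"
    using assms by simp
  ultimately have "((\<lambda>t. f (p + t *\<^sub>R v)) has_derivative (\<lambda>t. f' (t *\<^sub>R v))) (at 0)"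
    by (rule has_derivative_compose)
  moreover have "f' (t *\<^sub>R v) = t *\<^sub>R f' v" for t
    using assms has_derivative_linear linear_scale by blast
  ultimately show ?thesis
    unfolding differential_def by (intro vector_derivative_at) (simp add: has_vector_derivative_def)
qed

text \<open>Isolates what the metric computation uses: an orthonormal family and positive
  coefficients with infinite radius of convergence. The series in \<open>sqrt (a n)\<close> controls
  the vectors, the one in \<open>a n\<close> their squared norms.\<close>

locale power_series_state =
  fixes e :: "nat \<Rightarrow> 'a::complex_hilbert" and a :: "nat \<Rightarrow> real"
  assumes orthonormal: "cinner (e m) (e n) = (if m = n then 1 else 0)"
    and coeff_pos: "a n > 0"
    and summable_sqrt_coeff: "\<And>x. summable (\<lambda>n. sqrt (a n) * x ^ n)"
    and summable_coeff: "summable (\<lambda>n. a n * x ^ n)"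
begin

definition "V z = (\<Sum>n. z ^ n *\<^sub>C (sqrt (a n) *\<^sub>R e n))"
definition "V' z = (\<Sum>n. (of_nat n * z ^ (n - 1)) *\<^sub>C (sqrt (a n) *\<^sub>R e n))"
definition "\<N> x = (\<Sum>n. a n * x ^ n)"
definition "\<N>' x = (\<Sum>n. of_nat n * a n * x ^ (n - 1))"
text \<open>The quotient rule for the derivative of x \<open>\<N>'\<close>/\<open>\<N>\<close>,
  written out; the sum is the derivative of x \<open>\<N>'\<close>.\<close>

definition "W x = ((\<Sum>n. of_nat n * (of_nat n * a n) * x ^ (n - 1)) * \<N> x - x * \<N>' x * \<N>' x) / (\<N> x)\<^sup>2"
definition "\<psi> z = (\<N> ((cmod z)\<^sup>2) powr (- 1 / 2)) *\<^sub>R V z"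

lemma norm_e: "norm (e n) = 1"
proof -
  have "(norm (e n))\<^sup>2 = 1"
    by (simp add: norm_square_cinner orthonormal)
  then show ?thesis
    by (smt (verit) norm_ge_zero power2_eq_1_iff)
qed

lemma summable_norm_coeff: "\<And>R. summable (\<lambda>n. norm (sqrt (a n) *\<^sub>R e n) * R ^ n)"
  using summable_sqrt_coeff coeff_pos by (simp add: norm_e less_imp_le)

lemma scaleC_coeff: "c *\<^sub>C (sqrt (a n) *\<^sub>R e n) = (c * sqrt (a n)) *\<^sub>C e n"
  by (simp add: scaleC_of_real[symmetric] scaleC_scaleC)

lemma V_sums: "(\<lambda>n. (z ^ n * of_real (sqrt (a n))) *\<^sub>C e n) sums V z"
  using has_derivative_vector_power_series(1)[OF summable_norm_coeff] by (simp add: V_def scaleC_coeff)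

lemma V'_sums: "(\<lambda>n. (of_nat n * z ^ (n - 1) * of_real (sqrt (a n))) *\<^sub>C e n) sums V' z"
  using has_derivative_vector_power_series(2)[OF summable_norm_coeff] by (simp add: V'_def scaleC_coeff)

lemma V_has_derivative: "(V has_derivative (\<lambda>h. h *\<^sub>C V' z)) (at z)"
  using has_derivative_vector_power_series(3)[OF summable_norm_coeff]
  by (simp add: V_def[abs_def] V'_def)

section \<open>Inner products of \<open>V\<close> and \<open>V'\<close>\<close>

lemma cnj_power_mult: "cnj z ^ n * z ^ n = of_real ((cmod z)\<^sup>2 ^ n)"
  by (metis complex_norm_square mult.commute of_real_power power_mult_distrib)

lemma coeff_square: "complex_of_real (sqrt (a n)) * of_real (sqrt (a n)) = of_real (a n)"
  using coeff_pos[of n] by (simp flip: of_real_mult add: less_imp_le)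

lemma cinner_V_V: "cinner (V z) (V z) = of_real (\<N> ((cmod z)\<^sup>2))"
proof -
  have "cnj (z ^ n * sqrt (a n)) * (z ^ n * sqrt (a n)) = of_real (a n * (cmod z)\<^sup>2 ^ n)" for n
  proof -
    have "cnj (z ^ n * sqrt (a n)) * (z ^ n * sqrt (a n))
        = (cnj z ^ n * z ^ n) * (complex_of_real (sqrt (a n)) * of_real (sqrt (a n)))"
      by (simp add: ac_simps)
    then show ?thesis
      by (simp only: cnj_power_mult coeff_square) simp
  qed
  then have "(\<lambda>n. complex_of_real (a n * (cmod z)\<^sup>2 ^ n)) sums cinner (V z) (V z)"
    using cinner_orthonormal_sums[OF orthonormal V_sums V_sums, of z z] by simp
  moreover have "(\<lambda>n. complex_of_real (a n * (cmod z)\<^sup>2 ^ n)) sums of_real (\<N> ((cmod z)\<^sup>2))"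
    unfolding \<N>_def by (intro sums_of_real summable_sums summable_coeff)
  ultimately show ?thesis
    by (rule sums_unique2)
qed

lemma cinner_V_V': "cinner (V z) (V' z) = cnj z * of_real (\<N>' ((cmod z)\<^sup>2))"
proof -
  have "cnj (z ^ n * sqrt (a n)) * (of_nat n * z ^ (n - 1) * sqrt (a n))
      = cnj z * of_real (of_nat n * a n * (cmod z)\<^sup>2 ^ (n - 1))" for n
  \<comment> \<open>For positive \<open>n\<close> one factor \<open>cnj z\<close> stays unpaired and
    the rest combine to a power of |z|^2; at 0 both sides vanish through the factor
    \<open>n\<close>.\<close>
  proof (cases n)
    case (Suc m)
    have "cnj (z ^ n * sqrt (a n)) * (of_nat n * z ^ (n - 1) * sqrt (a n))
        = cnj z * (of_nat n * (complex_of_real (sqrt (a n)) * of_real (sqrt (a n))) * (cnj z ^ m * z ^ m))"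
      by (simp add: Suc ac_simps)
    then show ?thesis
      by (simp only: cnj_power_mult coeff_square) (simp add: Suc)
  qed simp
  then have "(\<lambda>n. cnj z * complex_of_real (of_nat n * a n * (cmod z)\<^sup>2 ^ (n - 1)))
      sums cinner (V z) (V' z)"
    using cinner_orthonormal_sums[OF orthonormal V_sums V'_sums, of z z] by (simp only:)
  moreover have "(\<lambda>n. cnj z * complex_of_real (of_nat n * a n * (cmod z)\<^sup>2 ^ (n - 1)))
      sums (cnj z * of_real (\<N>' ((cmod z)\<^sup>2)))"
    unfolding \<N>'_def
    by (intro sums_mult sums_of_real summable_sums entire_series_derivative(1) summable_coeff)
  ultimately show ?thesis
    by (rule sums_unique2)
qed

lemma summable_weighted_coeff: "summable (\<lambda>n. of_nat n * a n * x ^ n)"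
  using entire_series_Euler[OF summable_coeff] by (rule sums_summable)

text \<open>The weight is left as \<open>n * (n * a n)\<close> so that the sum reads as the
  derivative of the series with coefficients \<open>n * a n\<close>, that is of x
  \<open>\<N>'\<close>.\<close>

lemma cinner_V'_V':
  "cinner (V' z) (V' z) = of_real (\<Sum>n. of_nat n * (of_nat n * a n) * ((cmod z)\<^sup>2) ^ (n - 1))"
proof -
  have "cnj (of_nat n * z ^ (n - 1) * sqrt (a n)) * (of_nat n * z ^ (n - 1) * sqrt (a n))
      = of_real (of_nat n * (of_nat n * a n) * (cmod z)\<^sup>2 ^ (n - 1))" for n
  proof -
    have "cnj (of_nat n * z ^ (n - 1) * sqrt (a n)) * (of_nat n * z ^ (n - 1) * sqrt (a n))
        = of_nat n * (of_nat n * (complex_of_real (sqrt (a n)) * of_real (sqrt (a n))))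
           * (cnj z ^ (n - 1) * z ^ (n - 1))"
      by (simp add: ac_simps)
    then show ?thesis
      by (simp only: cnj_power_mult coeff_square) simp
  qed
  then have "(\<lambda>n. complex_of_real (of_nat n * (of_nat n * a n) * (cmod z)\<^sup>2 ^ (n - 1)))
      sums cinner (V' z) (V' z)"
    using cinner_orthonormal_sums[OF orthonormal V'_sums V'_sums, of z z] by (simp only:)
  moreover have "(\<lambda>n. complex_of_real (of_nat n * (of_nat n * a n) * (cmod z)\<^sup>2 ^ (n - 1)))
      sums of_real (\<Sum>n. of_nat n * (of_nat n * a n) * ((cmod z)\<^sup>2) ^ (n - 1))"
    by (intro sums_of_real summable_sums entire_series_derivative(1) summable_weighted_coeff)
  ultimately show ?thesis
    by (rule sums_unique2)
qed

section \<open>Positivity and logarithmic derivative of the normalization\<close>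

lemma \<N>_pos: "\<N> x > 0" if "x \<ge> 0"
proof -
  have "0 < (\<Sum>n<1. a n * x ^ n)"
    using coeff_pos[of 0] by simp
  also have "\<dots> \<le> \<N> x"
    unfolding \<N>_def
    by (rule sum_le_suminf[OF summable_coeff]) (use that coeff_pos in \<open>auto simp: less_imp_le\<close>)
  finally show ?thesis .
qed

lemma \<N>_has_derivative: "(\<N> has_real_derivative \<N>' x) (at x)"
  using entire_series_derivative(2)[OF summable_coeff] by (simp add: \<N>_def[abs_def] \<N>'_def)

lemma log_derivative_has_derivative:
  assumes "x \<ge> 0"
  shows "((\<lambda>x. x * (\<N>' x / \<N> x)) has_real_derivative W x) (at x)"
proof -
  have "(\<Sum>n. of_nat n * a n * x ^ n) = x * \<N>' x" for x
    using sums_unique[OF entire_series_Euler[OF summable_coeff]] by (simp add: \<N>'_def)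
  then have "((\<lambda>x. x * \<N>' x) has_real_derivative
      (\<Sum>n. of_nat n * (of_nat n * a n) * x ^ (n - 1))) (at x)"
    using entire_series_derivative(2)[OF summable_weighted_coeff, of x] by simp
  from DERIV_quotient[OF this \<N>_has_derivative] show ?thesis
    using \<N>_pos[OF assms] by (simp add: W_def power2_eq_square mult_ac)
qed

section \<open>The normalized state and its metric\<close>

lemma norm_\<psi>: "norm (\<psi> z) = 1"
proof -
  have "(norm (V z))\<^sup>2 = \<N> ((cmod z)\<^sup>2)"
    by (simp add: norm_square_cinner cinner_V_V)
  then have "norm (V z) = \<N> ((cmod z)\<^sup>2) powr (1 / 2)"
    by (metis norm_ge_zero powr_half_sqrt real_sqrt_unique zero_le_power2 \<N>_pos less_imp_le)
  then show ?thesis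
    using \<N>_pos[of "(cmod z)\<^sup>2"] by (simp add: \<psi>_def flip: powr_add)
qed

lemma normalizer_square: "(\<N> x powr (- 1 / 2))\<^sup>2 = 1 / \<N> x" if "x \<ge> 0"
  using \<N>_pos[OF that] by (simp add: power2_eq_square powr_minus_divide flip: powr_add)

text \<open>Product rule. The normalizer depends on \<open>z\<close> through |z|^2, whose real
  differential is \<open>2 * Re (cnj z * w)\<close>; the 2 cancels the 1/2 of the exponent, and this
  contribution stays along \<open>V z\<close>.\<close>

lemma \<psi>_has_derivative:
  fixes z :: complex
  defines "x \<equiv> (cmod z)\<^sup>2"
  defines "g \<equiv> \<N> x powr (- 1 / 2)"
  shows "(\<psi> has_derivative
      (\<lambda>w. (- (g * \<N>' x / \<N> x * Re (cnj z * w))) *\<^sub>R V z + (g *\<^sub>R (w *\<^sub>C V' z)))) (at z)"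
proof -
  have pos: "\<N> x > 0"
    by (simp add: x_def \<N>_pos)
  have sq: "((\<lambda>z. (cmod z)\<^sup>2) has_derivative (\<lambda>w. 2 * Re (cnj z * w))) (at z)"
    unfolding cmod_power2
    by (auto intro!: derivative_eq_intros simp: algebra_simps)
  have "((\<lambda>x. \<N> x powr (- 1 / 2)) has_real_derivative (- 1 / 2) * (g / \<N> x) * \<N>' x) (at x)"
  proof -
    have "((\<lambda>x. \<N> x powr (- 1 / 2)) has_real_derivative (- 1 / 2) * \<N> x powr (- 1 / 2 - 1) * \<N>' x) (at x)"
      using pos by (auto intro!: derivative_eq_intros DERIV_fun_powr \<N>_has_derivative)
    moreover have "\<N> x powr (- 1 / 2 - 1) = g / \<N> x"
      unfolding g_def using pos by (subst powr_diff) simp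
    ultimately show ?thesis
      by (simp add: mult.commute)
  qed
  then have "((\<lambda>x. \<N> x powr (- 1 / 2)) has_derivative ((*) ((- 1 / 2) * (g / \<N> x) * \<N>' x))) (at x)"
    by (simp only: has_field_derivative_def)
  note g_deriv = has_derivative_compose[OF sq this[unfolded x_def]]
  have "(- 1 / 2) * (g / \<N> x) * \<N>' x * (2 * t) = - (g * \<N>' x / \<N> x * t)" for t
    by simp
  with g_deriv
  have "((\<lambda>z. \<N> ((cmod z)\<^sup>2) powr (- 1 / 2)) has_derivative
      (\<lambda>w. - (g * \<N>' x / \<N> x * Re (cnj z * w)))) (at z)"
    unfolding x_def by (simp only:)
  from has_derivative_scaleR[OF this V_has_derivative] show ?thesis
    by (simp add: \<psi>_def[abs_def] g_def x_def add.commute)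
qed

lemma fubini_study_\<psi>: "fubini_study \<psi> z w = W ((cmod z)\<^sup>2) * (cmod w)\<^sup>2"
proof -
  define x where "x = (cmod z)\<^sup>2"
  define g where "g = \<N> x powr (- 1 / 2)"
  \<comment> \<open>\<open>s\<close> is half the derivative of |z|^2 along \<open>w\<close>, and
    \<open>t\<close> is the remaining angular part.\<close>
  define s where "s = Re (cnj z * w)"
  define t where "t = Im (cnj z * w)"
  define d where "d = \<N>' x / \<N> x"
  define S where "S = (\<Sum>n. of_nat n * (of_nat n * a n) * x ^ (n - 1))"
  have pos: "\<N> x > 0"
    by (simp add: x_def \<N>_pos)
  have gg: "g\<^sup>2 = 1 / \<N> x"
    unfolding g_def by (rule normalizer_square) (simp add: x_def)
  have D: "differential \<psi> z w = (- (g * d * s)) *\<^sub>R V z + g *\<^sub>R (w *\<^sub>C V' z)"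
    using differential_eq[OF \<psi>_has_derivative] by (simp add: x_def g_def s_def d_def)
  have VV: "(norm (V z))\<^sup>2 = \<N> x"
    by (simp add: norm_square_cinner cinner_V_V x_def)
  have DD: "(norm (V' z))\<^sup>2 = S"
    by (simp add: norm_square_cinner cinner_V'_V' x_def S_def)
  have VD: "cinner (V z) (w *\<^sub>C V' z) = of_real (\<N>' x) * Complex s t"
  proof -
    have "Complex s t = cnj z * w"
      by (simp add: s_def t_def complex_eq_iff)
    then show ?thesis
      by (simp add: cinner_scaleC_right cinner_V_V' x_def mult_ac)
  qed
  have st: "s\<^sup>2 + t\<^sup>2 = x * (cmod w)\<^sup>2"
  proof -
    have "s\<^sup>2 + t\<^sup>2 = (cmod (cnj z * w))\<^sup>2"
      by (simp only: s_def t_def cmod_power2)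
    then show ?thesis
      by (simp add: norm_mult power_mult_distrib x_def)
  qed
  have "(norm (differential \<psi> z w))\<^sup>2
      = g\<^sup>2 * (d\<^sup>2 * s\<^sup>2 * \<N> x - 2 * d * s * (\<N>' x * s) + (cmod w)\<^sup>2 * S)"
    unfolding D norm_add_square
    by (simp add: cinner_scaleR_left cinner_scaleR_right cinner_minus_left VD norm_scaleC power_mult_distrib VV DD)
       (simp add: algebra_simps power2_eq_square)
  also have "\<dots> = (cmod w)\<^sup>2 * S / \<N> x - d\<^sup>2 * s\<^sup>2"
    unfolding gg using pos by (simp add: d_def field_simps power2_eq_square)
  finally have 1: "(norm (differential \<psi> z w))\<^sup>2 = (cmod w)\<^sup>2 * S / \<N> x - d\<^sup>2 * s\<^sup>2" .
  have "cinner (\<psi> z) (differential \<psi> z w)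
      = of_real (g\<^sup>2) * (of_real (\<N>' x) * Complex s t - of_real (d * s * \<N> x))"
    unfolding D \<psi>_def x_def[symmetric] g_def[symmetric]
    by (simp only: cinner_add_right cinner_scaleR_left cinner_scaleR_right VD cinner_V_V x_def[symmetric])
       (simp add: algebra_simps power2_eq_square)
  \<comment> \<open>The real part cancels, as it must for a curve of unit vectors; only the phase
    component survives.\<close>
  also have "\<dots> = Complex 0 (d * t)"
    using pos by (simp add: gg d_def complex_eq_iff)
  finally have 2: "(cmod (cinner (\<psi> z) (differential \<psi> z w)))\<^sup>2 = d\<^sup>2 * t\<^sup>2"
    by (simp add: cmod_power2 power_mult_distrib)
  \<comment> \<open>The norm contributes \<open>- d^2 * s^2\<close> and the projection
    \<open>- d^2 * t^2\<close>; together they depend on \<open>w\<close> only through |w|^2, which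
    makes the metric isotropic.\<close>
  have "fubini_study \<psi> z w = (cmod w)\<^sup>2 * S / \<N> x - d\<^sup>2 * (s\<^sup>2 + t\<^sup>2)"
    unfolding fubini_study_def 1 2 by (simp add: algebra_simps)
  also have "\<dots> = W x * (cmod w)\<^sup>2"
    unfolding st W_def S_def[symmetric] using pos by (simp add: d_def field_simps power2_eq_square)
  finally show ?thesis
    by (simp add: x_def)
qed

section \<open>The number operator\<close>

lemma number_op_sums:
  "(\<lambda>n. (of_nat n * cinner (e n) (\<psi> z)) *\<^sub>C e n) sums
     ((\<N> ((cmod z)\<^sup>2) powr (- 1 / 2)) *\<^sub>R (z *\<^sub>C V' z))"
proof -
  define g where "g = \<N> ((cmod z)\<^sup>2) powr (- 1 / 2)"
  \<comment> \<open>On these power series the number operator acts as z d/dz, since z * z^(n-1) =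
    z^n; at \<open>n = 0\<close> both sides vanish. Convergence is inherited from the series of
    \<open>V'\<close>.\<close>
  have "g *\<^sub>R (z *\<^sub>C ((of_nat n * z ^ (n - 1) * sqrt (a n)) *\<^sub>C e n))
      = (of_nat n * cinner (e n) (\<psi> z)) *\<^sub>C e n" for n
    by (cases n)
       (simp_all add: \<psi>_def g_def cinner_scaleR_right cinner_orthonormal_coefficient[OF orthonormal V_sums]
         scaleR_scaleC scaleC_scaleC mult_ac)
  then show ?thesis
    using bounded_linear.sums[OF bounded_linear_scaleR_right
        bounded_linear.sums[OF bounded_linear_scaleC_right V'_sums], of g z z]
    by (simp add: g_def)
qed

text \<open>Parseval for the convergent series of the number operator: its inner product with itself
  is the required sum of squares.\<close>

lemma \<psi>_in_number_domain: "\<psi> z \<in> number_domain e"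
proof -
  let ?c = "\<lambda>n. of_nat n * cinner (e n) (\<psi> z)"
  have "summable (\<lambda>n. cnj (?c n) * ?c n)"
    using cinner_orthonormal_sums[OF orthonormal number_op_sums number_op_sums] by (rule sums_summable)
  moreover have "cnj (?c n) * ?c n = of_real ((real n * cmod (cinner (e n) (\<psi> z)))\<^sup>2)" for n
  proof -
    have "cnj (?c n) * ?c n = of_real ((cmod (?c n))\<^sup>2)"
      by (metis complex_norm_square mult.commute)
    then show ?thesis
      by (simp add: norm_mult)
  qed
  ultimately show ?thesis
    by (simp only: number_domain_def mem_Collect_eq summable_of_real_iff)
qed

text \<open>The factor \<open>z\<close> from the number operator completes the \<open>cnj z\<close>
  of \<open>cinner (V z) (V' z)\<close> to |z|^2, and the two normalizers give
  1/\<open>\<N>\<close>.\<close>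

lemma mean_number_\<psi>:
  "cinner (\<psi> z) (number_op e (\<psi> z)) =
     of_real ((cmod z)\<^sup>2 * (\<N>' ((cmod z)\<^sup>2) / \<N> ((cmod z)\<^sup>2)))"
proof -
  define g where "g = \<N> ((cmod z)\<^sup>2) powr (- 1 / 2)"
  have gg: "g\<^sup>2 = 1 / \<N> ((cmod z)\<^sup>2)"
    unfolding g_def by (rule normalizer_square) simp
  have "number_op e (\<psi> z) = g *\<^sub>R (z *\<^sub>C V' z)"
    unfolding number_op_def g_def using sums_unique[OF number_op_sums] by simp
  moreover have "\<psi> z = g *\<^sub>R V z"
    by (simp add: \<psi>_def g_def)
  ultimately have "cinner (\<psi> z) (number_op e (\<psi> z)) = of_real (g\<^sup>2) * ((z * cnj z) * of_real (\<N>' ((cmod z)\<^sup>2)))"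
    by (simp only: cinner_scaleR_left cinner_scaleR_right cinner_scaleC_right cinner_V_V')
       (simp add: power2_eq_square mult_ac)
  then show ?thesis
    by (simp add: gg flip: complex_norm_square)
qed

end

subsection \<open>The coherent states\<close>

text \<open>Follows from q^n \<le> q. The bound allows the new factor of the q-factorial to be
  dropped in the ratio estimate.\<close>

lemma q_number_ge_1:
  assumes "0 < q" and "q < 1" and "n \<ge> 1"
  shows "q_number q n \<ge> 1"
  using assms power_decreasing[of 1 n q] by (simp add: q_number_def field_simps)

lemma q_fact_Suc: "q_fact q (Suc n) = q_number q (Suc n) * q_fact q n"
  by (simp add: q_fact_def mult.commute)

lemma q_fact_pos: "q_fact q n > 0" if "0 < q" "q < 1"
  unfolding q_fact_def using q_number_ge_1[OF that] by (intro prod_pos) (force intro: less_le_trans)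

text \<open>The coefficients of the normalization; their square roots are those of the unnormalized
  state.\<close>

definition coherent_coeff :: "real \<Rightarrow> real \<Rightarrow> real \<Rightarrow> nat \<Rightarrow> real" where
  "coherent_coeff q l lam n =
     q powr (real n * (real n + 1) / 2) / ((l\<^sup>2 * q powr lam) ^ n * q_fact q n)"

lemma coherent_coeff_pos:
  assumes "0 < q" and "q < 1" and "l \<noteq> 0"
  shows "coherent_coeff q l lam n > 0"
  using assms q_fact_pos[of q n] by (simp add: coherent_coeff_def)

text \<open>The triangular number n(n+1)/2 grows by n+1, which produces the power of
  \<open>q\<close>. As this power tends to 0, the radius of convergence is infinite whatever the
  values of \<open>lam\<close> and of nonzero \<open>l\<close>.\<close>

lemma coherent_coeff_Suc_le:
  assumes "0 < q" and "q < 1" and "l \<noteq> 0"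
  shows "coherent_coeff q l lam (Suc n) \<le> q ^ Suc n / (l\<^sup>2 * q powr lam) * coherent_coeff q l lam n"
proof -
  define L where "L = l\<^sup>2 * q powr lam"
  have L: "L > 0"
    using assms by (simp add: L_def)
  have "real (Suc n) * (real (Suc n) + 1) / 2 = real (Suc n) + real n * (real n + 1) / 2"
    by (simp add: field_simps)
  then have "q powr (real (Suc n) * (real (Suc n) + 1) / 2)
      = q ^ Suc n * q powr (real n * (real n + 1) / 2)"
    using assms by (simp only: powr_add powr_realpow)
  then have "coherent_coeff q l lam (Suc n)
      = q ^ Suc n / L * coherent_coeff q l lam n / q_number q (Suc n)"
    by (simp add: coherent_coeff_def q_fact_Suc L_def mult_ac)
  also have "\<dots> \<le> q ^ Suc n / L * coherent_coeff q l lam n / 1"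
    using assms L coherent_coeff_pos[OF assms, of lam n] q_number_ge_1[of q "Suc n"]
    by (intro divide_left_mono mult_nonneg_nonneg) auto
  finally show ?thesis
    by (simp add: L_def)
qed

lemma power_series_state_coherent:
  assumes "0 < q" and "q < 1" and "l \<noteq> 0"
    and "\<And>m n. cinner (e m) (e n) = (if m = n then 1 else 0)"
  shows "power_series_state e (coherent_coeff q l lam)"
proof
  let ?a = "coherent_coeff q l lam"
  let ?r = "\<lambda>n. q ^ Suc n / (l\<^sup>2 * q powr lam)"
  have "?r \<longlonglongrightarrow> 0 / (l\<^sup>2 * q powr lam)"
    using assms by (intro tendsto_intros LIMSEQ_Suc[OF LIMSEQ_realpow_zero]) auto
  then have r: "?r \<longlonglongrightarrow> 0"
    by simp
  show "?a n > 0" for n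
    by (rule coherent_coeff_pos[OF assms(1-3)])
  then have nonneg: "?a n \<ge> 0" for n
    by (simp add: less_imp_le)
  show "summable (\<lambda>n. ?a n * x ^ n)" for x
    by (rule summable_power_series_ratio[OF nonneg coherent_coeff_Suc_le[OF assms(1-3)] r])
  \<comment> \<open>Square roots inherit the ratio bound with \<open>sqrt (?r n)\<close>, which
    still tends to 0.\<close>
  have "sqrt (?a (Suc n)) \<le> sqrt (?r n) * sqrt (?a n)" for n
    using coherent_coeff_Suc_le[OF assms(1-3)] by (simp only: real_sqrt_mult[symmetric] real_sqrt_le_iff)
  moreover have "(\<lambda>n. sqrt (?r n)) \<longlonglongrightarrow> 0"
    using tendsto_real_sqrt[OF r] by simp
  ultimately show "summable (\<lambda>n. sqrt (?a n) * x ^ n)" for x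
    using nonneg by (intro summable_power_series_ratio) auto
qed (rule assms(4))

section \<open>Polar coordinates\<close>

lemma differential_polar:
  "(cmod (differential (\<lambda>(r, \<theta>). rcis r \<theta>) (r, \<theta>) (dr, d\<theta>)))\<^sup>2 = dr\<^sup>2 + r\<^sup>2 * d\<theta>\<^sup>2"
proof -
  have "(\<lambda>(r, \<theta>). rcis r \<theta>) =
      (\<lambda>p. of_real (fst p * cos (snd p)) + \<i> * of_real (fst p * sin (snd p)))"
    by (auto simp: complex_eq_iff)
  moreover have "((\<lambda>p. of_real (fst p * cos (snd p)) + \<i> * of_real (fst p * sin (snd p))) has_derivative
      (\<lambda>v. of_real (fst v * cos \<theta> - r * sin \<theta> * snd v)
          + \<i> * of_real (fst v * sin \<theta> + r * cos \<theta> * snd v))) (at (r, \<theta>))"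
    by (auto intro!: derivative_eq_intros simp: algebra_simps)
  ultimately have "differential (\<lambda>(r, \<theta>). rcis r \<theta>) (r, \<theta>) (dr, d\<theta>)
      = Complex (dr * cos \<theta> - r * sin \<theta> * d\<theta>) (dr * sin \<theta> + r * cos \<theta> * d\<theta>)"
    by (subst differential_eq) (auto simp: complex_eq_iff)
  then have "(cmod (differential (\<lambda>(r, \<theta>). rcis r \<theta>) (r, \<theta>) (dr, d\<theta>)))\<^sup>2
      = (dr * cos \<theta> - r * sin \<theta> * d\<theta>)\<^sup>2 + (dr * sin \<theta> + r * cos \<theta> * d\<theta>)\<^sup>2"
    by (simp add: cmod_power2)
  also have "\<dots> = (dr\<^sup>2 + r\<^sup>2 * d\<theta>\<^sup>2) * ((sin \<theta>)\<^sup>2 + (cos \<theta>)\<^sup>2)"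
    unfolding power2_eq_square by (simp only: algebra_simps)
  finally show ?thesis
    by simp
qed

text \<open>\<open>deriv\<close>, \<open>differential\<close> and \<open>number_op\<close> are total
  functions; the differentiability and domain clauses ensure that their values here are the intended
  ones. The mean determines \<open>nbar\<close> for x \<ge> 0 only, hence the derivative within the
  half-line.\<close>

theorem proposition4p2:
  fixes e :: "nat \<Rightarrow> 'a::complex_hilbert"
    and q l lam :: real
  assumes "0 < q" and "q < 1" and "l \<noteq> 0"
    and "orthonormal_basis e"
  shows
    "(\<forall>z. norm (coherent_state e q l lam z) = 1
        \<and> coherent_state e q l lam differentiable (at z)
        \<and> coherent_state e q l lam z \<in> number_domain e)
   \<and> (\<forall>x\<ge>0. normalization q l lam differentiable (at x)
        \<and> log_deriv_term q l lam differentiable (at x))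
   \<and> (\<forall>z w. fubini_study (coherent_state e q l lam) z w
              = metric_factor q l lam ((cmod z)\<^sup>2) * (cmod w)\<^sup>2)
   \<and> (\<exists>nbar :: real \<Rightarrow> real.
        (\<forall>z. mean_number e q l lam z = complex_of_real (nbar ((cmod z)\<^sup>2)))
      \<and> (\<forall>x\<ge>0. (nbar has_real_derivative metric_factor q l lam x) (at x within {0..})))
   \<and> (\<forall>r\<ge>0. \<forall>\<theta> dr d\<theta>.
        fubini_study (coherent_state e q l lam) (rcis r \<theta>)
          (differential (\<lambda>(r, \<theta>). rcis r \<theta>) (r, \<theta>) (dr, d\<theta>))
        = metric_factor q l lam (r\<^sup>2) * (dr\<^sup>2 + r\<^sup>2 * d\<theta>\<^sup>2))"
proof -
  interpret power_series_state e "coherent_coeff q l lam"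
    using assms by (intro power_series_state_coherent) (auto simp: orthonormal_basis_def)
  have \<N>: "normalization q l lam = \<N>"
    by (simp add: fun_eq_iff normalization_def \<N>_def coherent_coeff_def)
  have "(complex_of_real (q powr (real n * (real n + 1) / 4)) * z ^ n /
             complex_of_real (sqrt ((l\<^sup>2 * q powr lam) ^ n * q_fact q n))) *\<^sub>C e n
      = z ^ n *\<^sub>C (sqrt (coherent_coeff q l lam n) *\<^sub>R e n)" for n z
  proof -
    have "sqrt (q powr (real n * (real n + 1) / 2)) = q powr (real n * (real n + 1) / 4)"
      using assms by (simp add: powr_half_sqrt[symmetric] powr_powr)
    then show ?thesis
      unfolding scaleC_coeff by (simp add: coherent_coeff_def real_sqrt_divide mult.commute)
  qed
  then have \<psi>: "coherent_state e q l lam = \<psi>"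
    by (simp add: fun_eq_iff coherent_state_def \<psi>_def V_def \<N>)
  \<comment> \<open>The equality covers negative arguments too, as the two-sided
    \<open>deriv\<close> at 0 in \<open>metric_factor\<close> requires.\<close>
  have "deriv \<N> = \<N>'"
    by (rule ext) (rule DERIV_imp_deriv[OF \<N>_has_derivative])
  then have log_deriv: "log_deriv_term q l lam = (\<lambda>x. x * (\<N>' x / \<N> x))"
    by (simp add: fun_eq_iff log_deriv_term_def \<N>)
  have W: "metric_factor q l lam x = W x" if "x \<ge> 0" for x
    unfolding metric_factor_def log_deriv
    using log_derivative_has_derivative[OF that] by (rule DERIV_imp_deriv)
  have fs: "fubini_study (coherent_state e q l lam) z w
      = metric_factor q l lam ((cmod z)\<^sup>2) * (cmod w)\<^sup>2" for z w
    by (simp add: \<psi> fubini_study_\<psi> W)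
  have mean: "mean_number e q l lam z = of_real (log_deriv_term q l lam ((cmod z)\<^sup>2))" for z
    by (simp add: mean_number_def \<psi> mean_number_\<psi> log_deriv)
  have deriv: "(log_deriv_term q l lam has_real_derivative metric_factor q l lam x) (at x)"
    if "x \<ge> 0" for x
    using log_derivative_has_derivative[OF that] by (simp add: log_deriv W that)
  show ?thesis
  \<comment> \<open>The witness for \<open>nbar\<close> is x
    \<open>\<N>'\<close>/\<open>\<N>\<close>, the mean computed in \<open>mean\<close>.\<close>
  proof (intro conjI allI impI exI[of _ "log_deriv_term q l lam"])
    show "norm (coherent_state e q l lam z) = 1" for z
      by (simp add: \<psi> norm_\<psi>)
    show "coherent_state e q l lam differentiable (at z)" for z
      unfolding \<psi> using \<psi>_has_derivative by (rule differentiableI)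
    show "coherent_state e q l lam z \<in> number_domain e" for z
      by (simp add: \<psi> \<psi>_in_number_domain)
    show "normalization q l lam differentiable (at x)" for x
      unfolding \<N> using \<N>_has_derivative real_differentiable_def by blast
    show "log_deriv_term q l lam differentiable (at x)" if "x \<ge> 0" for x
      using deriv[OF that] real_differentiable_def by blast
    show "(log_deriv_term q l lam has_real_derivative metric_factor q l lam x) (at x within {0..})"
      if "x \<ge> 0" for x
      using deriv[OF that] by (rule has_field_derivative_at_within)
  qed (simp_all add: fs mean differential_polar)
qed

end
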